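(* Let $\mathcal{A},\mathcal{B}$ be sets, $\mathcal{C}\subset\mathbb{R}$, and let $s_{y|x}:\mathbb{R}^D\to\mathbb{R}$ be continuously differentiable for all $x\in\mathcal{B}$, $y\in\mathcal{A}$. Assume that $\ell:\mathbb{R}\times\mathcal{C}\to\mathbb{R}$ and $\mathcal{R}:\mathbb{R}^D\to\mathbb{R}$ are continuously differentiable, that for any $c\in\mathcal{C}$ and any $(x,y,z)\in\mathcal{B}\times\mathcal{A}\times\mathcal{A}$ the function $\theta\mapsto\ell(s_{yz|x}(\theta),c)$ is convex, and that $\mathcal{R}$ is strongly convex on any compact set. (1) Suppose that $\ell$ is twice continuously differentiable in its first variable, $\mathcal{R}$ is twice continuously differentiable, $\mathcal{C}$ has a maximum, and $\partial_s\ell(s,\max\mathcal{C})<0$ for all $s\in\mathbb{R}$. Then $\mathrm{Loss}$ is globally pairwise monotone with respect to unequivocal comparisons: for any dataset $\mathbf{D}$, any $(x,y,z)\in\mathcal{B}\times\mathcal{A}\times\mathcal{A}$, and any dataset $\mathbf{D}'$ obtained from $\mathbf{D}$ by adding any number of copies of $(x,y,z,\max\mathcal{C})$, $$\forall\theta\in\operatorname*{arg\,min}\mathrm{Loss}(\cdot|\mathbf{D}),\ \forall\theta'\in\operatorname*{arg\,min}\mathrm{Loss}(\cdot|\mathbf{D}'):\quad s_{yz|x}(\theta')\ge s_{yz|x}(\theta).$$ (2) Suppose that $\mathcal{C}$ is an interval of $\mathbb{R}$, $\ell$ and $\mathcal{R}$ are twice continuously differentiable, and $\partial_c\partial_s\ell(s,c)<0$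 for all $s\in\mathbb{R}$, $c\in\mathcal{C}$. Then $\mathrm{Loss}$ is globally pairwise monotone with respect to comparison intensification: for any dataset $\mathbf{D}$, any $(x,y,z)\in\mathcal{B}\times\mathcal{A}\times\mathcal{A}$, and any dataset $\mathbf{D}'$ obtained from $\mathbf{D}$ by an intensification of the comparisons $yz|x$ in favor of $y$, the same conclusion holds, i.e. $s_{yz|x}(\theta')\ge s_{yz|x}(\theta)$ for all $\theta\in\operatorname*{arg\,min}\mathrm{Loss}(\cdot|\mathbf{D})$ and all $\theta'\in\operatorname*{arg\,min}\mathrm{Loss}(\cdot|\mathbf{D}')$.
   Context: $\mathcal{A}$ is a set of alternatives, $\mathcal{B}$ a set of backgrounds, $\mathcal{C}\subset\mathbb{R}$ a set of possible comparison values. A dataset $\mathbf{D}$ is a finite multiset of elements $(x,y,z,c)\in\mathcal{B}\times\mathcal{A}\times\mathcal{A}\times\mathcal{C}$. For a parametrized score $s_{y|x}(\theta)\in\mathbb{R}$ ($\theta\in\mathbb{R}^D$), write $s_{yz|x}(\theta)=s_{y|x}(\theta)-s_{z|x}(\theta)$. The loss is $$\mathrm{Loss}(\theta|\mathbf{D})=\mathcal{R}(\theta)+\sum_{(x,y,z,c)\in\mathbf{D}}\ell(s_{yz|x}(\theta),c).$$ $\partial_s,\partial_c$ are derivatives of $\ell(s,c)$ in the first and second variables. "Strongly convex on any compact set" means: for every compact convex $K\subset\mathbb{R}^D$ there is $\mu_K>0$ such that $\mathcal{R}$ is $\mu_K$-strongly convex on $K$. Minimizers are over $\mathbb{R}^D$.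 An intensification of the comparisons $yz|x$ in $\mathbf{D}$ in favor of $y$ replaces entries $(x,y,z,c)$ of $\mathbf{D}$ by $(x,y,z,\tilde c)$ with $\tilde c\in\mathcal{C}$, $\tilde c\ge c$, and entries $(x,z,y,c)$ by $(x,z,y,\tilde c)$ with $\tilde c\in\mathcal{C}$, $\tilde c\le c$, leaving all other entries unchanged. *)

theory Defs
  imports "HOL-Analysis.Analysis"
begin

(* Derivatives are taken within S.  For S = UNIV this is ordinary continuous differentiability;
   for S = UNIV \<times> \<C> they are one-sided at the end points of \<C>.  At points where the derivative
   within S is not unique (e.g. \<C> has an isolated point) some continuous choice must exist. *)
definition C1_on :: "'v::real_normed_vector set \<Rightarrow> ('v \<Rightarrow> 'w::real_normed_vector) \<Rightarrow> bool" where
  "C1_on S f \<longleftrightarrow>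
     (\<exists>f' :: 'v \<Rightarrow> ('v \<Rightarrow>\<^sub>L 'w).
        (\<forall>p\<in>S. (f has_derivative blinfun_apply (f' p)) (at p within S)) \<and> continuous_on S f')"

definition C2_on :: "'v::real_normed_vector set \<Rightarrow> ('v \<Rightarrow> 'w::real_normed_vector) \<Rightarrow> bool" where
  "C2_on S f \<longleftrightarrow>
     (\<exists>f' :: 'v \<Rightarrow> ('v \<Rightarrow>\<^sub>L 'w).
        (\<forall>p\<in>S. (f has_derivative blinfun_apply (f' p)) (at p within S)) \<and> C1_on S f')"

definition strongly_convex_on :: "real \<Rightarrow> 'v::real_normed_vector set \<Rightarrow> ('v \<Rightarrow> real) \<Rightarrow> bool" where
  "strongly_convex_on \<mu> K f \<longleftrightarrow>
     (\<forall>u\<in>K. \<forall>v\<in>K. \<forall>t\<in>{0..1}.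
        f ((1 - t) *\<^sub>R u + t *\<^sub>R v)
          \<le> (1 - t) * f u + t * f v - \<mu> / 2 * t * (1 - t) * (norm (u - v))\<^sup>2)"

definition strongly_convex_on_compacts :: "('v::real_normed_vector \<Rightarrow> real) \<Rightarrow> bool" where
  "strongly_convex_on_compacts f \<longleftrightarrow>
     (\<forall>K. compact K \<and> convex K \<longrightarrow> (\<exists>\<mu>>0. strongly_convex_on \<mu> K f))"

(* An entry (x, y, z, c) compares alternatives y and z against background x, with value c. *)
type_synonym ('b, 'a) entry = "'b \<times> 'a \<times> 'a \<times> real"

definition dataset :: "'b set \<Rightarrow> 'a set \<Rightarrow> real set \<Rightarrow> ('b, 'a) entry multiset \<Rightarrow> bool" where
  "dataset \<B> \<A> \<C> D \<longleftrightarrow> set_mset D \<subseteq> \<B> \<times> \<A> \<times> \<A> \<times> \<C>"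

(* s x y \<theta> is the score of alternative y given background x. *)
definition score_diff :: "('b \<Rightarrow> 'a \<Rightarrow> 'v \<Rightarrow> real) \<Rightarrow> 'b \<Rightarrow> 'a \<Rightarrow> 'a \<Rightarrow> 'v \<Rightarrow> real" where
  "score_diff s x y z \<theta> = s x y \<theta> - s x z \<theta>"

definition Loss :: "('b \<Rightarrow> 'a \<Rightarrow> 'v \<Rightarrow> real) \<Rightarrow> (real \<Rightarrow> real \<Rightarrow> real) \<Rightarrow> ('v \<Rightarrow> real) \<Rightarrow>
    ('b, 'a) entry multiset \<Rightarrow> 'v \<Rightarrow> real" where
  "Loss s ell \<R> D \<theta> = \<R> \<theta> + (\<Sum>(x, y, z, c)\<in>#D. ell (score_diff s x y z \<theta>) c)"

definition adds_comparisons :: "real \<Rightarrow> 'b \<Rightarrow> 'a \<Rightarrow> 'a \<Rightarrow>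
    ('b, 'a) entry multiset \<Rightarrow> ('b, 'a) entry multiset \<Rightarrow> bool" where
  "adds_comparisons c x y z D D' \<longleftrightarrow> (\<exists>n. D' = D + replicate_mset n (x, y, z, c))"

definition intensifies_entry :: "real set \<Rightarrow> 'b \<Rightarrow> 'a \<Rightarrow> 'a \<Rightarrow>
    ('b, 'a) entry \<Rightarrow> ('b, 'a) entry \<Rightarrow> bool" where
  "intensifies_entry \<C> x y z e e' \<longleftrightarrow>
     e' = e \<or>
     (\<exists>c. \<exists>c'\<in>\<C>. e = (x, y, z, c) \<and> e' = (x, y, z, c') \<and> c' \<ge> c) \<or>
     (\<exists>c. \<exists>c'\<in>\<C>. e = (x, z, y, c) \<and> e' = (x, z, y, c') \<and> c' \<le> c)"

definition intensification :: "real set \<Rightarrow> 'b \<Rightarrow> 'a \<Rightarrow> 'a \<Rightarrow>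
    ('b, 'a) entry multiset \<Rightarrow> ('b, 'a) entry multiset \<Rightarrow> bool" where
  "intensification \<C> x y z D D' \<longleftrightarrow> rel_mset (intensifies_entry \<C> x y z) D D'"

(* upd x y z D D' says that D' is an update of D in favor of y over z given x. *)
definition globally_pairwise_monotone :: "'b set \<Rightarrow> 'a set \<Rightarrow> real set \<Rightarrow>
    ('b \<Rightarrow> 'a \<Rightarrow> 'v \<Rightarrow> real) \<Rightarrow> (('b, 'a) entry multiset \<Rightarrow> 'v \<Rightarrow> real) \<Rightarrow>
    ('b \<Rightarrow> 'a \<Rightarrow> 'a \<Rightarrow> ('b, 'a) entry multiset \<Rightarrow> ('b, 'a) entry multiset \<Rightarrow> bool) \<Rightarrow> bool" where
  "globally_pairwise_monotone \<B> \<A> \<C> s L upd \<longleftrightarrow>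
     (\<forall>D D'. \<forall>x\<in>\<B>. \<forall>y\<in>\<A>. \<forall>z\<in>\<A>.
        dataset \<B> \<A> \<C> D \<and> dataset \<B> \<A> \<C> D' \<and> upd x y z D D' \<longrightarrow>
        (\<forall>\<theta> \<theta>'. is_arg_min (L D) (\<lambda>_. True) \<theta> \<and> is_arg_min (L D') (\<lambda>_. True) \<theta>' \<longrightarrow>
           score_diff s x y z \<theta>' \<ge> score_diff s x y z \<theta>))"

end

theory Submission
  imports Defs
begin

text \<open>In both parts, \<open>Loss(\<theta>|D') = Loss(\<theta>|D) + h(s\<^sub>y\<^sub>z\<^sub>|\<^sub>x(\<theta>))\<close>, where the function \<open>h\<close> of one
  real variable is either zero or strictly decreasing. In the first case both losses coincide and,
  by strict convexity, have at most one minimizer. In the second case, adding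
  \<open>Loss(\<theta>|D) \<le> Loss(\<theta>'|D)\<close> and \<open>Loss(\<theta>'|D') \<le> Loss(\<theta>|D')\<close> gives
  \<open>h(s\<^sub>y\<^sub>z\<^sub>|\<^sub>x(\<theta>')) \<le> h(s\<^sub>y\<^sub>z\<^sub>|\<^sub>x(\<theta>))\<close>, and the claim follows.\<close>

definition zero_or_decreasing :: "(real \<Rightarrow> real) \<Rightarrow> bool" where
  "zero_or_decreasing h \<longleftrightarrow> (\<forall>r. h r = 0) \<or> (\<forall>u v. u < v \<longrightarrow> h v < h u)"

lemma zero_or_decreasing_add:
  assumes "zero_or_decreasing f" "zero_or_decreasing g"
  shows "zero_or_decreasing (\<lambda>r. f r + g r)"
  using assms by (auto simp: zero_or_decreasing_def intro: add_strict_mono)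

text \<open>For \<open>n = 0\<close> the product is the zero function: no copy is added.\<close>

lemma zero_or_decreasing_of_nat_mult:
  assumes "zero_or_decreasing f"
  shows "zero_or_decreasing (\<lambda>r. real n * f r)"
  using assms by (cases "n = 0") (auto simp: zero_or_decreasing_def)

lemma score_diff_swap: "score_diff s x z y \<theta> = - score_diff s x y z \<theta>"
  by (simp add: score_diff_def)

lemma Loss_empty [simp]: "Loss s ell \<R> {#} \<theta> = \<R> \<theta>"
  by (simp add: Loss_def)

lemma Loss_add_mset [simp]:
  "Loss s ell \<R> (add_mset (x, y, z, c) D) \<theta> = ell (score_diff s x y z \<theta>) c + Loss s ell \<R> D \<theta>"
  by (simp add: Loss_def)

lemma Loss_add_replicate_mset:
  "Loss s ell \<R> (D + replicate_mset n (x, y, z, c)) \<theta> =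
     Loss s ell \<R> D \<theta> + real n * ell (score_diff s x y z \<theta>) c"
  by (simp add: Loss_def algebra_simps)

text \<open>What remains is a finite sum of convex terms, one per entry. Splitting off
  \<open>\<R>\<close> leaves its strong convexity available for the uniqueness of
  minimizers.\<close>

lemma convex_on_Loss_minus_regularizer:
  assumes cvx: "\<And>x y z c. x \<in> \<B> \<Longrightarrow> y \<in> \<A> \<Longrightarrow> z \<in> \<A> \<Longrightarrow> c \<in> \<C> \<Longrightarrow>
      convex_on UNIV (\<lambda>\<theta>. ell (score_diff s x y z \<theta>) c)"
    and "dataset \<B> \<A> \<C> D"
  shows "convex_on UNIV (\<lambda>\<theta>. Loss s ell \<R> D \<theta> - \<R> \<theta>)"
  using assms(2)
proof (induction D)
  case empty
  then show ?case by (simp add: convex_on_const)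
next
  case (add e D)
  obtain x y z c where e: "e = (x, y, z, c)" by (cases e)
  have "convex_on UNIV (\<lambda>\<theta>. ell (score_diff s x y z \<theta>) c + (Loss s ell \<R> D \<theta> - \<R> \<theta>))"
    using add by (intro convex_on_add cvx) (auto simp: dataset_def e)
  then show ?case by (simp add: e algebra_simps)
qed

text \<open>The segment between two minimizers is compact and convex, so \<open>R\<close> is
  strongly convex on it. Together with convexity of \<open>F - R\<close>, this would make
  \<open>F\<close> at the midpoint strictly smaller than the mean of its two minimal values.\<close>

lemma arg_min_unique_if_strongly_convex_on_compacts:
  fixes R :: "'v::real_normed_vector \<Rightarrow> real"
  assumes R: "strongly_convex_on_compacts R"
    and cvx: "convex_on UNIV (\<lambda>v. F v - R v)"
    and min: "is_arg_min F (\<lambda>_. True) u" "is_arg_min F (\<lambda>_. True) v"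
  shows "u = v"
proof (rule ccontr)
  assume "u \<noteq> v"
  obtain \<mu> where "\<mu> > 0" and sc: "strongly_convex_on \<mu> (closed_segment u v) R"
    using R unfolding strongly_convex_on_compacts_def
    by (meson compact_segment convex_closed_segment)
  \<comment> \<open>The midpoint, written as \<open>(1 - t) *\<^sub>R u + t *\<^sub>R v\<close> with
    \<open>t = 1/2\<close> to fit both convexity inequalities.\<close>
  define w where "w = (1 - 1/2) *\<^sub>R u + (1/2) *\<^sub>R v"
  have "R w \<le> (1 - 1/2) * R u + 1/2 * R v - \<mu> / 2 * (1/2) * (1 - 1/2) * (norm (u - v))\<^sup>2"
    using sc unfolding strongly_convex_on_def w_def
    by (elim ballE[where x = u] ballE[where x = v] ballE[where x = "1/2"]) auto
  moreover have "F w - R w \<le> (1 - 1/2) * (F u - R u) + 1/2 * (F v - R v)"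
    unfolding w_def using convex_onD[OF cvx, of "1/2" u v] by simp
  moreover have "\<mu> * (norm (u - v))\<^sup>2 > 0"
    using \<open>\<mu> > 0\<close> \<open>u \<noteq> v\<close> by simp
  moreover have "F u \<le> F w" "F v \<le> F w"
    using min by (auto simp: is_arg_min_linorder)
  ultimately show False by (simp add: field_simps)
qed

text \<open>The comparison argument without datasets: \<open>F\<close> and \<open>G\<close> are the
  losses before and after the update, \<open>q\<close> is the score difference. Uniqueness settles
  the case of vanishing \<open>h\<close>, where both points minimize the same function.\<close>

lemma arg_min_add_zero_or_decreasing_mono:
  assumes g: "\<And>\<theta>. G \<theta> = F \<theta> + h (q \<theta>)"
    and h: "zero_or_decreasing h"
    and unique: "\<And>u v. is_arg_min F (\<lambda>_. True) u \<Longrightarrow> is_arg_min F (\<lambda>_. True) v \<Longrightarrow> u = v"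
    and min: "is_arg_min F (\<lambda>_. True) \<theta>" "is_arg_min G (\<lambda>_. True) \<theta>'"
  shows "q \<theta> \<le> q \<theta>'"
proof (cases "\<forall>r. h r = 0")
  case True
  then have "G = F" using g by auto
  then show ?thesis using unique min by auto
next
  case False
  then have dec: "\<And>u v. u < v \<Longrightarrow> h v < h u"
    using h by (auto simp: zero_or_decreasing_def)
  have "F \<theta> \<le> F \<theta>'" "F \<theta>' + h (q \<theta>') \<le> F \<theta> + h (q \<theta>)"
    using min by (auto simp: is_arg_min_linorder g)
  then show ?thesis using dec[of "q \<theta>'" "q \<theta>"] by linarith
qed

text \<open>The line of constant \<open>c\<close> lies in the domain, and the joint derivative
  restricts to it. Along this line the derivative is two-sided even if \<open>c\<close> is an end
  point of \<open>C\<close>, so \<open>deriv\<close> denotes a true derivative.\<close>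

lemma C1_on_Times_has_deriv_fst:
  fixes f :: "real \<Rightarrow> real \<Rightarrow> real"
  assumes "C1_on (UNIV \<times> C) (\<lambda>(r, c). f r c)" "c \<in> C"
  shows "((\<lambda>r. f r c) has_real_derivative deriv (\<lambda>r. f r c) r) (at r)"
proof -
  obtain f' :: "real \<times> real \<Rightarrow> (real \<times> real) \<Rightarrow>\<^sub>L real" where
    "\<forall>p\<in>UNIV \<times> C. ((\<lambda>(r, c). f r c) has_derivative blinfun_apply (f' p)) (at p within UNIV \<times> C)"
    using assms(1) unfolding C1_on_def by blast
  then have "((\<lambda>(r, c). f r c) has_derivative blinfun_apply (f' (r, c))) (at (r, c) within UNIV \<times> C)"
    using assms(2) by auto
  then have "((\<lambda>(r, c). f r c) has_derivative blinfun_apply (f' (r, c)))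
      (at (r, c) within (\<lambda>r. (r, c)) ` UNIV)"
    by (rule has_derivative_subset) (use assms(2) in auto)
  moreover have "((\<lambda>r. (r, c)) has_derivative (\<lambda>t. (t, 0))) (at r)"
    by (auto intro!: derivative_eq_intros)
  ultimately have "((\<lambda>r. case (r, c) of (r, c) \<Rightarrow> f r c) has_derivative
      (\<lambda>t. blinfun_apply (f' (r, c)) (t, 0))) (at r)"
    by (rule has_derivative_in_compose[rotated])
  then have "(\<lambda>r. f r c) differentiable (at r)"
    by (auto intro: differentiableI)
  then show ?thesis
    using DERIV_deriv_iff_real_differentiable by blast
qed

text \<open>The mean value theorem on \<open>{a..b}\<close>, which lies in \<open>C\<close> because
  \<open>C\<close> is an interval. Derivatives within \<open>C\<close> restrict to it, so end points
  of \<open>C\<close> are covered.\<close>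

lemma decreasing_on_interval_if_has_negative_derivative:
  fixes f :: "real \<Rightarrow> real"
  assumes C: "is_interval C" and "a \<in> C" "b \<in> C" "a < b"
    and deriv: "\<And>c. c \<in> C \<Longrightarrow> \<exists>m<0. (f has_real_derivative m) (at c within C)"
  shows "f b < f a"
proof -
  have sub: "{a..b} \<subseteq> C"
    using C assms(2,3) by (meson atLeastAtMost_iff mem_is_interval_1_I subsetI)
  obtain m where m: "\<And>c. c \<in> C \<Longrightarrow> m c < 0 \<and> (f has_real_derivative m c) (at c within C)"
    using deriv by metis
  have "\<exists>c\<in>{a<..<b}. f b - f a = m c * (b - a)"
  proof (rule mvt_simple[OF \<open>a < b\<close>])
    fix c assume "a \<le> c" "c \<le> b"
    then have "(f has_real_derivative m c) (at c within {a..b})"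
      using m sub by (meson DERIV_subset atLeastAtMost_iff subsetD)
    then show "(f has_derivative (*) (m c)) (at c within {a..b})"
      by (simp add: has_field_derivative_def)
  qed
  then obtain c where "c \<in> {a<..<b}" "f b - f a = m c * (b - a)" by blast
  moreover have "m c * (b - a) < 0"
    using m sub \<open>c \<in> {a<..<b}\<close> \<open>a < b\<close> by (intro mult_neg_pos) (auto simp: subset_iff)
  ultimately show ?thesis by linarith
qed

text \<open>The derivative in \<open>r\<close> of the difference is \<open>d r c' - d r c\<close>,
  which is negative because \<open>d r\<close> decreases along \<open>C\<close>.\<close>

lemma decreasing_difference:
  fixes f :: "real \<Rightarrow> real \<Rightarrow> real"
  assumes diff: "\<And>r c. c \<in> C \<Longrightarrow> ((\<lambda>r. f r c) has_real_derivative d r c) (at r)"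
    and C: "is_interval C" and cc: "c \<in> C" "c' \<in> C" "c < c'"
    and neg: "\<And>r c. c \<in> C \<Longrightarrow> \<exists>m<0. (d r has_real_derivative m) (at c within C)"
    and "u < v"
  shows "f v c' - f v c < f u c' - f u c"
proof (rule DERIV_neg_imp_decreasing[OF \<open>u < v\<close>])
  fix r
  have "((\<lambda>r. f r c' - f r c) has_real_derivative d r c' - d r c) (at r)"
    using cc by (intro DERIV_diff diff)
  moreover have "d r c' < d r c"
    using decreasing_on_interval_if_has_negative_derivative[OF C cc neg] .
  ultimately show "\<exists>y. ((\<lambda>r. f r c' - f r c) has_real_derivative y) (at r) \<and> y < 0"
    by (intro exI[of _ "d r c' - d r c"]) simp
qed

text \<open>The function \<open>h\<close> is the change of \<open>ell\<close> from the old to the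
  new comparison value. It does not depend on the remaining entries \<open>D\<close>, which allows
  entries to be exchanged one at a time.\<close>

lemma intensifies_entry_Loss:
  assumes dec: "\<And>c c' u v. c \<in> \<C> \<Longrightarrow> c' \<in> \<C> \<Longrightarrow> c < c' \<Longrightarrow> u < v \<Longrightarrow>
      ell v c' - ell v c < ell u c' - ell u c"
    and "intensifies_entry \<C> x y z e e'" "dataset \<B> \<A> \<C> {#e#}"
  obtains h where "zero_or_decreasing h"
    "\<And>\<theta> D. Loss s ell \<R> (add_mset e' D) \<theta> =
        Loss s ell \<R> (add_mset e D) \<theta> + h (score_diff s x y z \<theta>)"
proof -
  \<comment> \<open>An intensification with equal values falls under the first case, so the other
    two have strict inequalities, as \<open>dec\<close> requires.\<close>
  consider "e' = e"
    | c c' where "c \<in> \<C>" "c' \<in> \<C>" "e = (x, y, z, c)" "e' = (x, y, z, c')" "c < c'"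
    | c c' where "c \<in> \<C>" "c' \<in> \<C>" "e = (x, z, y, c)" "e' = (x, z, y, c')" "c' < c"
  proof -
    have "c \<in> \<C>" if "e = (u, v, w, c)" for u v w c
      using assms(3) that by (simp add: dataset_def)
    then show ?thesis
      using assms(2) that unfolding intensifies_entry_def le_less by metis
  qed
  then show ?thesis
  proof cases
    case 1
    show ?thesis by (rule that[of "\<lambda>_. 0"]) (simp_all add: 1 zero_or_decreasing_def)
  next
    case 2
    show ?thesis
    proof (rule that)
      show "zero_or_decreasing (\<lambda>r. ell r c' - ell r c)"
        using dec 2 by (simp add: zero_or_decreasing_def)
    qed (simp add: 2)
  next
    case 3
    show ?thesis
    proof (rule that)
      \<comment> \<open>Swapping the alternatives negates the score difference and reverses the
        change of \<open>c\<close>; the two reversals cancel.\<close>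
      have "ell (- v) c' - ell (- v) c < ell (- u) c' - ell (- u) c" if "u < v" for u v
        using dec[of c' c "- v" "- u"] 3 that by simp
      then show "zero_or_decreasing (\<lambda>r. ell (- r) c' - ell (- r) c)"
        by (simp add: zero_or_decreasing_def)
    qed (simp add: 3 score_diff_swap[of s x z y])
  qed
qed

text \<open>Enumerating both multisets by lists matched entry by entry reduces the claim to an
  induction that adds up one function per entry.\<close>

lemma intensification_Loss:
  assumes dec: "\<And>c c' u v. c \<in> \<C> \<Longrightarrow> c' \<in> \<C> \<Longrightarrow> c < c' \<Longrightarrow> u < v \<Longrightarrow>
      ell v c' - ell v c < ell u c' - ell u c"
    and "intensification \<C> x y z D D'" "dataset \<B> \<A> \<C> D"
  shows "\<exists>h. zero_or_decreasing h \<and>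
    (\<forall>\<theta>. Loss s ell \<R> D' \<theta> = Loss s ell \<R> D \<theta> + h (score_diff s x y z \<theta>))"
proof -
  obtain es es' where "list_all2 (intensifies_entry \<C> x y z) es es'"
    and "mset es = D" "mset es' = D'"
    using assms(2) unfolding intensification_def rel_mset_def by blast
  then show ?thesis using assms(3)
  proof (induction es es' arbitrary: D D' rule: list_all2_induct)
    case Nil
    then show ?case by (auto intro!: exI[of _ "\<lambda>_. 0"] simp: zero_or_decreasing_def)
  next
    case (Cons e es e' es')
    have ds: "dataset \<B> \<A> \<C> {#e#}" "dataset \<B> \<A> \<C> (mset es)"
      using Cons.prems by (auto simp: dataset_def)
    obtain f where f: "zero_or_decreasing f"
      "\<And>\<theta> D. Loss s ell \<R> (add_mset e' D) \<theta> =
          Loss s ell \<R> (add_mset e D) \<theta> + f (score_diff s x y z \<theta>)"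
      using intensifies_entry_Loss[where ell = ell, OF dec Cons.hyps(1) ds(1)] by blast
    obtain g where g: "zero_or_decreasing g"
      "\<And>\<theta>. Loss s ell \<R> (mset es') \<theta> = Loss s ell \<R> (mset es) \<theta> + g (score_diff s x y z \<theta>)"
      using Cons.IH[OF refl refl ds(2)] by blast
    \<comment> \<open>The head is exchanged in front of the intensified tail \<open>es'\<close>,
      contributing \<open>f\<close>; the tail is then exchanged, contributing
      \<open>g\<close>.\<close>
    have "Loss s ell \<R> D' \<theta> = Loss s ell \<R> D \<theta> +
        (f (score_diff s x y z \<theta>) + g (score_diff s x y z \<theta>))" for \<theta>
      using Cons.prems(1,2) f(2)[of "mset es'" \<theta>] g(2)[of \<theta>]
      by (cases e) auto
    then show ?case using zero_or_decreasing_add[OF f(1) g(1)] by blast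
  qed
qed

theorem theorem3:
  fixes \<A> :: "'a set" and \<B> :: "'b set" and \<C> :: "real set"
    and s :: "'b \<Rightarrow> 'a \<Rightarrow> real ^ 'd \<Rightarrow> real"
    and ell :: "real \<Rightarrow> real \<Rightarrow> real"
    and \<R> :: "real ^ 'd \<Rightarrow> real"
  assumes "\<And>x y. x \<in> \<B> \<Longrightarrow> y \<in> \<A> \<Longrightarrow> C1_on UNIV (s x y)"
    and "C1_on (UNIV \<times> \<C>) (\<lambda>(r, c). ell r c)"
    and "C1_on UNIV \<R>"
    and "\<And>x y z c. x \<in> \<B> \<Longrightarrow> y \<in> \<A> \<Longrightarrow> z \<in> \<A> \<Longrightarrow> c \<in> \<C> \<Longrightarrow>
           convex_on UNIV (\<lambda>\<theta>. ell (score_diff s x y z \<theta>) c)"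
    and "strongly_convex_on_compacts \<R>"
  shows "(\<forall>cmax. (\<forall>c\<in>\<C>. C2_on UNIV (\<lambda>r. ell r c)) \<and> C2_on UNIV \<R> \<and>
            cmax \<in> \<C> \<and> (\<forall>c\<in>\<C>. c \<le> cmax) \<and>
            (\<forall>r. deriv (\<lambda>r. ell r cmax) r < 0) \<longrightarrow>
            globally_pairwise_monotone \<B> \<A> \<C> s (Loss s ell \<R>) (adds_comparisons cmax)) \<and>
         (is_interval \<C> \<and> C2_on (UNIV \<times> \<C>) (\<lambda>(r, c). ell r c) \<and> C2_on UNIV \<R> \<and>
            (\<forall>r. \<forall>c\<in>\<C>. \<exists>m<0.
               ((\<lambda>c. deriv (\<lambda>r. ell r c) r) has_real_derivative m) (at c within \<C>)) \<longrightarrow>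
            globally_pairwise_monotone \<B> \<A> \<C> s (Loss s ell \<R>) (intensification \<C>))"
proof -
  have unique: "u = v"
    if "dataset \<B> \<A> \<C> D" "is_arg_min (Loss s ell \<R> D) (\<lambda>_. True) u"
      "is_arg_min (Loss s ell \<R> D) (\<lambda>_. True) v" for D u v
    using arg_min_unique_if_strongly_convex_on_compacts[OF assms(5)
        convex_on_Loss_minus_regularizer[OF assms(4) that(1)] that(2,3)] .
  \<comment> \<open>Both parts now reduce to exhibiting \<open>h\<close> for their kind of
    update.\<close>
  have mono: "globally_pairwise_monotone \<B> \<A> \<C> s (Loss s ell \<R>) upd"
    if step: "\<And>x y z D D'. upd x y z D D' \<Longrightarrow> dataset \<B> \<A> \<C> D \<Longrightarrow>
        \<exists>h. zero_or_decreasing h \<and>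
          (\<forall>\<theta>. Loss s ell \<R> D' \<theta> = Loss s ell \<R> D \<theta> + h (score_diff s x y z \<theta>))" for upd
    unfolding globally_pairwise_monotone_def
  proof (intro allI ballI impI, elim conjE)
    fix D D' x y z \<theta> \<theta>'
    assume D: "dataset \<B> \<A> \<C> D" and upd: "upd x y z D D'"
      and min: "is_arg_min (Loss s ell \<R> D) (\<lambda>_. True) \<theta>"
        "is_arg_min (Loss s ell \<R> D') (\<lambda>_. True) \<theta>'"
    obtain h where h: "zero_or_decreasing h"
      "\<And>\<theta>. Loss s ell \<R> D' \<theta> = Loss s ell \<R> D \<theta> + h (score_diff s x y z \<theta>)"
      using step[OF upd D] by blast
    show "score_diff s x y z \<theta> \<le> score_diff s x y z \<theta>'"
      by (rule arg_min_add_zero_or_decreasing_mono[OF h(2,1) unique[OF D] min])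
  qed
  have diff: "((\<lambda>r. ell r c) has_real_derivative deriv (\<lambda>r. ell r c) r) (at r)" if "c \<in> \<C>" for r c
    using C1_on_Times_has_deriv_fst[OF assms(2) that] .
  show ?thesis
  proof (intro conjI allI impI; elim conjE)
    fix cmax
    assume cmax: "cmax \<in> \<C>" and neg: "\<forall>r. deriv (\<lambda>r. ell r cmax) r < 0"
    have "ell v cmax < ell u cmax" if "u < v" for u v
      using DERIV_neg_imp_decreasing[OF that] diff[OF cmax] neg by blast
    then have "zero_or_decreasing (\<lambda>r. ell r cmax)"
      by (simp add: zero_or_decreasing_def)
    then have dec: "zero_or_decreasing (\<lambda>r. real n * ell r cmax)" for n
      by (rule zero_or_decreasing_of_nat_mult)
    show "globally_pairwise_monotone \<B> \<A> \<C> s (Loss s ell \<R>) (adds_comparisons cmax)"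
      by (rule mono) (use dec in \<open>force simp: adds_comparisons_def Loss_add_replicate_mset\<close>)
  next
    assume C: "is_interval \<C>"
      and neg: "\<forall>r. \<forall>c\<in>\<C>. \<exists>m<0.
        ((\<lambda>c. deriv (\<lambda>r. ell r c) r) has_real_derivative m) (at c within \<C>)"
    \<comment> \<open>The negative mixed derivative makes the effect of raising \<open>c\<close> on
      the loss strictly decreasing in the score difference.\<close>
    have dec: "ell v c' - ell v c < ell u c' - ell u c"
      if "c \<in> \<C>" "c' \<in> \<C>" "c < c'" "u < v" for c c' u v
      by (rule decreasing_difference[where f = ell and d = "\<lambda>r c. deriv (\<lambda>r. ell r c) r",
          OF diff C that(1-3) _ that(4)])
        (use neg in auto)
    show "globally_pairwise_monotone \<B> \<A> \<C> s (Loss s ell \<R>) (intensification \<C>)"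
      by (rule mono) (rule intensification_Loss[where ell = ell, OF dec])
  qed
qed

end
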